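(* Let $\mathbb{K}$ be a field, let $n>3$ be an integer and let $G_n=\mathrm{SL}(n,\mathbb{K})$. For every $\phi\in H^1(G_n,A_n^* )$ there exist a derivation $\alpha_\phi$ of $\mathbb{K}$ and a $1$-cocycle $f\in Z^1(G_n,A_n^* )$ whose cohomology class is $\phi$ such that $$f(u_{kh}(s))=[\alpha_\phi(s)\mathbf{e}_{kh}]$$ for all distinct $k,h\in\{1,\dots,n\}$ and all $s\in\mathbb{K}$.
   Context: $\mathcal{M}_n$ is the space of $n\times n$ matrices over $\mathbb{K}$, $\mathcal{I}_n$ its subspace of scalar matrices, $A_n\subset \mathcal{M}_n$ the subspace of traceless matrices. $G_n$ acts on the right on $\mathcal{M}_n$ and $A_n$ by $x\cdot g=g^{-1}xg$. The dual module $A_n^*$ of $A_n$ is identified with the $G_n$-module $\mathcal{M}_n/\mathcal{I}_n$ (the class $[x]=x+\mathcal{I}_n$ corresponding to the functional $a\mapsto\mathrm{Tr}(xa)$), with action $[x]\cdot g=[g^{-1}xg]$. For a right $G_n$-module $V$: $Z^1(G_n,V)$ is the space of maps $f:G_n\to V$ with $f(g_1g_2)=f(g_1)\cdot g_2+f(g_2)$; $B^1(G_n,V)$ is the space of maps $g\mapsto v-v\cdot g$ with $v\in V$; $H^1(G_n,V)=Z^1(G_n,V)/B^1(G_n,V)$. $\mathbf{e}_{kh}$ is the $n\times n$ matrix with $(k,h)$-entry $1$ and all other entries $0$; for $k\ne h$ and $s\in\mathbb{K}$, $u_{kh}(s)=I_n+s\mathbf{e}_{kh}\in G_n$. A derivation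 of $\mathbb{K}$ is a map $d:\mathbb{K}\to\mathbb{K}$ with $d(x+y)=d(x)+d(y)$ and $d(xy)=d(x)y+xd(y)$. *)

theory Defs
  imports "HOL-Analysis.Analysis" "HOL-Algebra.Group"
begin

section \<open>The special linear group\<close>

definition SL :: "('a::field^'n^'n) monoid" where
  "SL = \<lparr>carrier = {g. det g = 1}, mult = (**), one = mat 1\<rparr>"

lemma SL_simps [simp]:
  "carrier SL = {g. det g = 1}" "mult SL = (**)" "one SL = mat 1"
  by (simp_all add: SL_def)

lemma SL_invertible:
  fixes g :: "'a::field^'n^'n"
  assumes "det g = 1"
  shows "g ** matrix_inv g = mat 1" "matrix_inv g ** g = mat 1" "det (matrix_inv g) = 1"
proof -
  have "invertible g"
    using assms by (simp add: invertible_det_nz)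
  then have "\<exists>h. g ** h = mat 1 \<and> h ** g = mat 1"
    by (simp add: invertible_def)
  then have "g ** matrix_inv g = mat 1 \<and> matrix_inv g ** g = mat 1"
    unfolding matrix_inv_def by (rule someI_ex)
  then show *: "g ** matrix_inv g = mat 1" "matrix_inv g ** g = mat 1"
    by auto
  show "det (matrix_inv g) = 1"
    using arg_cong[OF *(1), of det] assms by (simp add: det_mul)
qed

lemma group_SL: "group (SL :: ('a::field^'n^'n) monoid)"
proof (rule groupI)
  fix g :: "'a^'n^'n"
  assume "g \<in> carrier SL"
  then show "\<exists>h\<in>carrier SL. h \<otimes>\<^bsub>SL\<^esub> g = \<one>\<^bsub>SL\<^esub>"
    by (intro bexI[of _ "matrix_inv g"]) (simp_all add: SL_invertible)
qed (simp_all add: det_mul matrix_mul_assoc)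

lemma inv_SL:
  fixes g :: "'a::field^'n^'n"
  assumes "g \<in> carrier SL"
  shows "inv\<^bsub>SL\<^esub> g = matrix_inv g"
  by (rule group.inv_equality[OF group_SL]) (use assms SL_invertible in auto)

definition mat_unit :: "'n \<Rightarrow> 'n \<Rightarrow> 'a::zero_neq_one^'n^'n" where
  "mat_unit k h = (\<chi> i j. if i = k \<and> j = h then 1 else 0)"

text \<open>The library's scalar multiplication of matrices is only available over real algebras.\<close>

definition mat_scale :: "'a::times \<Rightarrow> 'a^'n^'n \<Rightarrow> 'a^'n^'n" where
  "mat_scale s x = (\<chi> i j. s * x $ i $ j)"

definition transvection :: "'n \<Rightarrow> 'n \<Rightarrow> 'a::field \<Rightarrow> 'a^'n^'n" where
  "transvection k h s = mat 1 + mat_scale s (mat_unit k h)"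


section \<open>The module of matrices modulo scalar matrices\<close>

text \<open>The dual of the module of traceless matrices, the class of \<open>x\<close> being the
  functional \<open>a \<mapsto> Tr (x a)\<close>. Recall that \<open>mat c\<close> is the scalar matrix \<open>c I\<close>.\<close>

definition scalar_rel :: "'a::field^'n^'n \<Rightarrow> 'a^'n^'n \<Rightarrow> bool" where
  "scalar_rel x y \<longleftrightarrow> x - y \<in> range mat"

lemma mat_arith:
  "mat (a + b) = mat a + (mat b :: 'a::field^'n^'n)"
  "mat (a - b) = mat a - (mat b :: 'a::field^'n^'n)"
  "mat (- a) = - (mat a :: 'a::field^'n^'n)"
  by (simp_all add: mat_def vec_eq_iff)

lemma scalar_relE:
  assumes "scalar_rel x y"
  obtains c where "x = y + mat c"
  using assms by (auto simp: scalar_rel_def algebra_simps)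

lemma scalar_relI: "x = y + mat c \<Longrightarrow> scalar_rel x y"
  by (simp add: scalar_rel_def)

lemma equivp_scalar_rel: "equivp (scalar_rel :: 'a::field^'n^'n \<Rightarrow> _)"
proof (rule equivpI)
  show "reflp (scalar_rel :: 'a^'n^'n \<Rightarrow> _)"
    by (rule reflpI) (auto simp: scalar_rel_def intro: range_eqI[of _ _ 0])
  show "symp (scalar_rel :: 'a^'n^'n \<Rightarrow> _)"
  proof (rule sympI)
    fix x y :: "'a^'n^'n"
    assume "scalar_rel x y"
    then obtain a where "x - y = mat a"
      by (auto simp: scalar_rel_def)
    then have "y - x = mat (- a)"
      by (simp add: mat_arith(3) flip: minus_diff_eq[of x y])
    then show "scalar_rel y x"
      by (simp add: scalar_rel_def)
  qed
  show "transp (scalar_rel :: 'a^'n^'n \<Rightarrow> _)"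
  proof (rule transpI)
    fix x y z :: "'a^'n^'n"
    assume "scalar_rel x y" "scalar_rel y z"
    then obtain a b where "x - y = mat a" "y - z = mat b"
      by (auto simp: scalar_rel_def)
    then have "x - z = mat (a + b)"
      by (simp add: mat_arith(1) algebra_simps)
    then show "scalar_rel x z"
      by (simp add: scalar_rel_def)
  qed
qed

quotient_type (overloaded) ('a, 'n) mat_mod_scalars = "'a::field^'n^'n" / scalar_rel
  morphisms mat_rep mat_class
  by (rule equivp_scalar_rel)

instantiation mat_mod_scalars :: (field, finite) ab_group_add
begin

lift_definition zero_mat_mod_scalars :: "('a, 'b) mat_mod_scalars" is 0 .

lift_definition plus_mat_mod_scalars ::
  "('a, 'b) mat_mod_scalars \<Rightarrow> ('a, 'b) mat_mod_scalars \<Rightarrow> ('a, 'b) mat_mod_scalars" is "(+)"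
proof (elim scalar_relE)
  fix x y z w :: "'a^'b^'b" and c d
  assume "x = y + mat c" "z = w + mat d"
  then show "scalar_rel (x + z) (y + w)"
    by (intro scalar_relI[of _ _ "c + d"]) (simp add: mat_arith)
qed

lift_definition uminus_mat_mod_scalars ::
  "('a, 'b) mat_mod_scalars \<Rightarrow> ('a, 'b) mat_mod_scalars" is uminus
proof (elim scalar_relE)
  fix x y :: "'a^'b^'b" and c
  assume "x = y + mat c"
  then show "scalar_rel (- x) (- y)"
    by (intro scalar_relI[of _ _ "- c"]) (simp add: mat_arith)
qed

lift_definition minus_mat_mod_scalars ::
  "('a, 'b) mat_mod_scalars \<Rightarrow> ('a, 'b) mat_mod_scalars \<Rightarrow> ('a, 'b) mat_mod_scalars" is "(-)"
proof (elim scalar_relE)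
  fix x y z w :: "'a^'b^'b" and c d
  assume "x = y + mat c" "z = w + mat d"
  then show "scalar_rel (x - z) (y - w)"
    by (intro scalar_relI[of _ _ "c - d"]) (simp add: mat_arith)
qed

instance
  by standard (transfer; simp add: algebra_simps equivp_reflp[OF equivp_scalar_rel])+

end

lemma mat_class_eq_iff: "mat_class x = mat_class y \<longleftrightarrow> x - y \<in> range mat"
  by (simp add: mat_mod_scalars.abs_eq_iff scalar_rel_def)

lemma mat_class_rep [simp]: "mat_class (mat_rep v) = v"
  by (rule Quotient3_abs_rep[OF Quotient3_mat_mod_scalars])

text \<open>Independent of the representative only for invertible \<open>g\<close>,
  see \<open>conj_act_class\<close> below; it is only used for \<open>g\<close> in \<open>SL\<close>.\<close>

definition conj_act ::
  "('a::field, 'n::finite) mat_mod_scalars \<Rightarrow> 'a^'n^'n \<Rightarrow> ('a, 'n) mat_mod_scalars" where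
  "conj_act v g = mat_class (matrix_inv g ** mat_rep v ** g)"

lemma conj_act_class:
  fixes g :: "'a::field^'n^'n"
  assumes "g \<in> carrier SL"
  shows "conj_act (mat_class x) g = mat_class (matrix_inv g ** x ** g)"
proof -
  have "mat_class (mat_rep (mat_class x)) = mat_class x"
    by simp
  then obtain c where c: "mat_rep (mat_class x) - x = mat c"
    unfolding mat_class_eq_iff by auto
  have comm: "matrix_inv g ** mat c = mat c ** matrix_inv g"
    by (simp add: vec_eq_iff matrix_matrix_mult_def mat_def if_distrib if_distribR
        mult.commute cong: if_cong)
  have "matrix_inv g ** mat_rep (mat_class x) ** g - matrix_inv g ** x ** g
      = matrix_inv g ** (mat_rep (mat_class x) - x) ** g"
    by (simp add: matrix_matrix_mult_def vec_eq_iff sum_subtractf sum_distrib_left sum_distrib_right algebra_simps)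
  also have "\<dots> = mat c ** (matrix_inv g ** g)"
    by (simp only: c comm matrix_mul_assoc)
  also have "\<dots> = mat c"
    using assms by (simp add: SL_invertible)
  finally show ?thesis
    by (simp add: conj_act_def mat_class_eq_iff)
qed


lemma conj_act_right_action:
  fixes g h :: "'a::field^'n^'n"
  assumes "g \<in> carrier SL" "h \<in> carrier SL"
  shows "conj_act v (mat 1) = v"
    and "conj_act v (g ** h) = conj_act (conj_act v g) h"
    and "conj_act (v + w) g = conj_act v g + conj_act w g"
proof -
  obtain x y where xy: "v = mat_class x" "w = mat_class y"
    by (metis mat_class_rep)
  have 1: "matrix_inv (mat 1) = (mat 1 :: 'a^'n^'n)"
    using SL_invertible(1)[of "mat 1 :: 'a^'n^'n"] by simp
  have gh: "g ** h \<in> carrier SL"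
    using assms by (simp add: det_mul)
  have 2: "matrix_inv (g ** h) = matrix_inv h ** matrix_inv g"
    using group.inv_mult_group[OF group_SL assms] gh assms by (simp only: inv_SL SL_simps)
  have 3: "a ** (x + y) ** b = a ** x ** b + a ** y ** b" for a b :: "'a^'n^'n"
    by (simp add: matrix_add_ldistrib matrix_matrix_mult_def vec_eq_iff sum.distrib
        distrib_left distrib_right)
  show "conj_act v (mat 1) = v"
    by (simp add: xy conj_act_class 1)
  show "conj_act v (g ** h) = conj_act (conj_act v g) h"
    by (simp only: xy conj_act_class[OF gh] conj_act_class[OF assms(1)]
        conj_act_class[OF assms(2)] 2 matrix_mul_assoc)
  show "conj_act (v + w) g = conj_act v g + conj_act w g"
    by (simp only: xy conj_act_class[OF assms(1)] plus_mat_mod_scalars.abs_eq 3)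
qed


section \<open>First cohomology with coefficients in a right module\<close>

text \<open>The map \<open>\<lambda>v g. act v g\<close> is a right action of \<open>G\<close>. Maps defined on the group are
  represented by functions that are \<open>undefined\<close> outside of the carrier, so that equality of
  cocycles is equality on the group.\<close>

definition cocycles ::
  "('g, 'r) monoid_scheme \<Rightarrow> ('v::ab_group_add \<Rightarrow> 'g \<Rightarrow> 'v) \<Rightarrow> ('g \<Rightarrow> 'v) set" where
  "cocycles G act = {f \<in> carrier G \<rightarrow>\<^sub>E UNIV.
     \<forall>g\<in>carrier G. \<forall>h\<in>carrier G. f (g \<otimes>\<^bsub>G\<^esub> h) = act (f g) h + f h}"

definition coboundaries ::
  "('g, 'r) monoid_scheme \<Rightarrow> ('v::ab_group_add \<Rightarrow> 'g \<Rightarrow> 'v) \<Rightarrow> ('g \<Rightarrow> 'v) set" where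
  "coboundaries G act = range (\<lambda>v. \<lambda>g\<in>carrier G. v - act v g)"

definition cohomologous ::
  "('g, 'r) monoid_scheme \<Rightarrow> ('v::ab_group_add \<Rightarrow> 'g \<Rightarrow> 'v) \<Rightarrow> (('g \<Rightarrow> 'v) \<times> ('g \<Rightarrow> 'v)) set" where
  "cohomologous G act = {(f, f'). f \<in> cocycles G act \<and> f' \<in> cocycles G act \<and>
     (\<lambda>g\<in>carrier G. f g - f' g) \<in> coboundaries G act}"

definition H1 ::
  "('g, 'r) monoid_scheme \<Rightarrow> ('v::ab_group_add \<Rightarrow> 'g \<Rightarrow> 'v) \<Rightarrow> ('g \<Rightarrow> 'v) set set" where
  "H1 G act = cocycles G act // cohomologous G act"

definition cohomology_class ::
  "('g, 'r) monoid_scheme \<Rightarrow> ('v::ab_group_add \<Rightarrow> 'g \<Rightarrow> 'v) \<Rightarrow> ('g \<Rightarrow> 'v) \<Rightarrow> ('g \<Rightarrow> 'v) set" where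
  "cohomology_class G act f = cohomologous G act `` {f}"


section \<open>Derivations\<close>

definition derivation :: "('a::field \<Rightarrow> 'a) \<Rightarrow> bool" where
  "derivation d \<longleftrightarrow> (\<forall>x y. d (x + y) = d x + d y) \<and> (\<forall>x y. d (x * y) = d x * y + x * d y)"

end

theory Submission
  imports Defs
begin

text \<open>
  Let \<open>X\<^sub>i\<^sub>j(s)\<close> represent the value of the cocycle at \<open>u\<^sub>i\<^sub>j(s)\<close>. Comparing entries in the cocycle
  identity for commuting pairs \<open>u\<^sub>i\<^sub>j(s)\<close>, \<open>u\<^sub>k\<^sub>l(t)\<close> shows that, modulo scalars, \<open>X\<^sub>i\<^sub>j(s)\<close> is supported on
  row \<open>i\<close> and column \<open>j\<close>, and that all its entries except the \<open>(i,j)\<close> one are multiples by \<open>\<plusminus>s\<close> of the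
  entries of one matrix \<open>v\<close> that does not depend on \<open>i\<close>, \<open>j\<close>, \<open>s\<close>. These are exactly the entries of the
  coboundary of \<open>v\<close>, and subtracting it leaves \<open>q\<^sub>i\<^sub>j(s) e\<^sub>i\<^sub>j\<close>. The relation
  \<open>[u\<^sub>i\<^sub>k(s), u\<^sub>k\<^sub>j(t)] = u\<^sub>i\<^sub>j(st)\<close> then reads \<open>q\<^sub>i\<^sub>j(st) = t q\<^sub>i\<^sub>k(s) + s q\<^sub>k\<^sub>j(t)\<close>: the numbers \<open>q\<^sub>i\<^sub>j(1)\<close> are
  differences \<open>d\<^sub>j - d\<^sub>i\<close>, so a diagonal coboundary removes them, after which all \<open>q\<^sub>i\<^sub>j\<close> agree and the
  relation is the Leibniz rule.
\<close>

section \<open>Transvections\<close>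

lemma transvection_nth:
  "transvection k l t $ r $ q = (if r = q then 1 else 0) + (if r = k \<and> q = l then t else 0)"
  by (simp add: transvection_def mat_scale_def mat_unit_def mat_def)

lemma mult_transvection_nth:
  fixes x :: "'a::field^'n^'n"
  shows "(x ** transvection k l t) $ r $ q = x $ r $ q + (if q = l then t * x $ r $ k else 0)"
proof -
  have "(x ** transvection k l t) $ r $ q
      = (\<Sum>m\<in>UNIV. (if m = q then x $ r $ m else 0) + (if m = k then if q = l then t * x $ r $ m else 0 else 0))"
    unfolding matrix_matrix_mult_def transvection_nth vec_lambda_beta
    by (intro sum.cong) (auto simp: algebra_simps)
  then show ?thesis
    by (simp add: sum.distrib)
qed

lemma transvection_mult_nth:
  fixes x :: "'a::field^'n^'n"
  shows "(transvection k l t ** x) $ r $ q = x $ r $ q + (if r = k then t * x $ l $ q else 0)"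
proof -
  have "(transvection k l t ** x) $ r $ q
      = (\<Sum>m\<in>UNIV. (if m = r then x $ m $ q else 0) + (if m = l then if r = k then t * x $ m $ q else 0 else 0))"
    unfolding matrix_matrix_mult_def transvection_nth vec_lambda_beta
    by (intro sum.cong) (auto simp: algebra_simps)
  then show ?thesis
    by (simp add: sum.distrib)
qed

lemma transvection_mult_same:
  assumes "k \<noteq> l"
  shows "transvection k l s ** transvection k l t = transvection k l (s + t)"
  using assms by (auto simp: vec_eq_iff mult_transvection_nth transvection_nth)

lemma transvection_0 [simp]: "transvection k l 0 = mat 1"
  by (simp add: vec_eq_iff transvection_nth mat_def)

lemma transvection_commute:
  assumes "j \<noteq> k" "i \<noteq> l"
  shows "transvection i j s ** transvection k l t = transvection k l t ** transvection i j s"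
  using assms by (auto simp: vec_eq_iff mult_transvection_nth transvection_nth)

text \<open>The relation \<open>[g, h] = x\<close> in the form \<open>g h = x (h g)\<close>, so that
  a cocycle need not be evaluated at an inverse.\<close>

lemma transvection_commutator:
  assumes "i \<noteq> j" "i \<noteq> k" "j \<noteq> k"
  shows "transvection i k s ** transvection k j t
    = transvection i j (s * t) ** (transvection k j t ** transvection i k s)"
  using assms by (auto simp: vec_eq_iff mult_transvection_nth transvection_mult_nth transvection_nth)

lemma transvection_in_SL:
  assumes "k \<noteq> l"
  shows "transvection k l t \<in> carrier SL"
proof -
  have "transvection k l t = (\<chi> r. if r = k then row k (mat 1) + t *s row l (mat 1) else row r (mat 1))"
    by (auto simp: vec_eq_iff transvection_nth row_def mat_def)
  then show ?thesis
    using assms by (simp add: det_row_operation)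
qed

lemma matrix_inv_transvection:
  assumes "k \<noteq> l"
  shows "matrix_inv (transvection k l t) = transvection k l (- t)"
proof -
  have "inv\<^bsub>SL\<^esub> (transvection k l t) = transvection k l (- t)"
    by (rule group.inv_equality[OF group_SL])
      (use assms transvection_in_SL in \<open>auto simp: transvection_mult_same\<close>)
  then show ?thesis
    by (simp only: inv_SL[OF transvection_in_SL[OF assms]])
qed

text \<open>For \<open>k \<noteq> l\<close> this is \<open>u^-1 x u - x\<close> with
  \<open>u = transvection k l t\<close>.\<close>

definition conj_diff :: "'n \<Rightarrow> 'n \<Rightarrow> 'a \<Rightarrow> 'a::field^'n^'n \<Rightarrow> 'a^'n^'n" where
  "conj_diff k l t x = (\<chi> r q. (if q = l then t * x $ r $ k else 0) - (if r = k then t * x $ l $ q else 0)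
    - (if r = k \<and> q = l then t * t * x $ l $ k else 0))"

lemma conj_diff_nth:
  "conj_diff k l t x $ r $ q = (if q = l then t * x $ r $ k else 0) - (if r = k then t * x $ l $ q else 0)
    - (if r = k \<and> q = l then t * t * x $ l $ k else 0)"
  by (simp add: conj_diff_def)

lemma conj_act_transvection:
  assumes "k \<noteq> l"
  shows "conj_act (mat_class x) (transvection k l t) = mat_class (x + conj_diff k l t x)"
proof -
  have "transvection k l (- t) ** x ** transvection k l t = x + conj_diff k l t x"
    by (auto simp: vec_eq_iff mult_transvection_nth transvection_mult_nth conj_diff_nth algebra_simps)
  then show ?thesis
    by (simp add: conj_act_class[OF transvection_in_SL[OF assms]] matrix_inv_transvection[OF assms])
qed


section \<open>Cocycles on transvections\<close>

lemma cocycleD: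
  assumes "f \<in> cocycles SL conj_act" "g \<in> carrier SL" "h \<in> carrier SL"
  shows "f (g ** h) = conj_act (f g) h + f h"
  using assms by (auto simp: cocycles_def)

lemma mat_class_add: "mat_class x + mat_class y = mat_class (x + y)"
  by (simp add: plus_mat_mod_scalars.abs_eq)

lemma range_mat_off_diag:
  assumes "x \<in> range mat" "r \<noteq> q"
  shows "x $ r $ q = 0"
  using assms by (auto simp: mat_def)

lemma range_mat_diag:
  assumes "x \<in> range mat"
  shows "x $ r $ r = x $ q $ q"
  using assms by (auto simp: mat_def)

text \<open>The representatives \<open>X\<close> stay arbitrary because the locale serves twice:
  with those picked by \<open>mat_rep\<close>, then with multiples of matrix units.\<close>

locale transvection_cocycle =
  fixes f :: "'a::field^'n^'n \<Rightarrow> ('a, 'n::finite) mat_mod_scalars"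
    and X :: "'n \<Rightarrow> 'n \<Rightarrow> 'a \<Rightarrow> 'a^'n^'n"
  assumes card: "CARD('n) > 3"
    and cocycle: "f \<in> cocycles SL conj_act"
    and f_eq: "i \<noteq> j \<Longrightarrow> f (transvection i j s) = mat_class (X i j s)"
begin

text \<open>The bound \<open>n > 3\<close> enters here.\<close>

lemma other_index: obtains m :: 'n where "m \<noteq> a" "m \<noteq> b" "m \<noteq> c"
proof -
  have "card {a, b, c} \<le> 3"
    by (simp add: card_insert_if)
  then have "{a, b, c} \<noteq> UNIV"
    using card by auto
  then show thesis
    using that by blast
qed

section \<open>Group relations read on representatives\<close>

lemma commute:
  assumes "i \<noteq> j" "k \<noteq> l" "j \<noteq> k" "i \<noteq> l"
  shows "conj_diff k l t (X i j s) - conj_diff i j s (X k l t) \<in> range mat"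
proof -
  have "conj_act (f (transvection i j s)) (transvection k l t) + f (transvection k l t)
      = conj_act (f (transvection k l t)) (transvection i j s) + f (transvection i j s)"
    using cocycleD[OF cocycle] transvection_commute[OF assms(3,4)] transvection_in_SL assms(1,2)
    by metis
  then show ?thesis
    using assms by (simp add: f_eq conj_act_transvection mat_class_add mat_class_eq_iff algebra_simps)
qed

lemma additive:
  assumes "i \<noteq> j"
  shows "X i j s + conj_diff i j t (X i j s) + X i j t - X i j (s + t) \<in> range mat"
proof -
  have "f (transvection i j (s + t)) = conj_act (f (transvection i j s)) (transvection i j t) + f (transvection i j t)"
    using cocycleD[OF cocycle] transvection_mult_same transvection_in_SL assms by metis
  from this[symmetric] show ?thesis
    using assms by (simp add: f_eq conj_act_transvection mat_class_add mat_class_eq_iff)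
qed

text \<open>\<open>Y\<close> represents the value at \<open>transvection i j (s * t)\<close> acted
  on by \<open>transvection k j t\<close>. The terms \<open>X i k s + X k j t\<close> occur on both
  sides of the relation and cancel.\<close>

lemma commutator:
  fixes s t
  assumes "i \<noteq> j" "i \<noteq> k" "j \<noteq> k"
  defines "Y \<equiv> X i j (s * t) + conj_diff k j t (X i j (s * t))"
  shows "Y + conj_diff i k s Y + conj_diff i k s (X k j t) - conj_diff k j t (X i k s) \<in> range mat"
proof -
  let ?g = "transvection i k s" and ?h = "transvection k j t" and ?x = "transvection i j (s * t)"
  have SL: "?g \<in> carrier SL" "?h \<in> carrier SL" "?x \<in> carrier SL"
    using assms(1-3) not_sym[OF assms(3)] by (simp_all add: transvection_in_SL del: SL_simps)
  then have "?h ** ?g \<in> carrier SL"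
    by (simp add: det_mul)
  then have "f (?x ** (?h ** ?g)) = conj_act (conj_act (f ?x) ?h) ?g + (conj_act (f ?h) ?g + f ?g)"
    using SL by (simp only: cocycleD[OF cocycle] conj_act_right_action(2))
  also have "?x ** (?h ** ?g) = ?g ** ?h"
    by (rule transvection_commutator[OF assms(1-3), symmetric])
  also have "f \<dots> = conj_act (f ?g) ?h + f ?h"
    by (rule cocycleD[OF cocycle SL(1,2)])
  finally show ?thesis
    using assms(1-3) not_sym[OF assms(3)] unfolding eq_commute[of "conj_act (f ?g) ?h + f ?h"]
    by (simp add: f_eq conj_act_transvection mat_class_add mat_class_eq_iff Y_def algebra_simps)
qed

section \<open>Vanishing entries and relations on the diagonal\<close>

text \<open>For \<open>l\<close> outside \<open>i\<close>, \<open>j\<close>, \<open>r\<close>,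
  commuting with \<open>transvection i l 1\<close> leaves only this entry at position
  \<open>(r, l)\<close>.\<close>

lemma col_zero:
  assumes "i \<noteq> j" "r \<noteq> i"
  shows "X i j s $ r $ i = 0"
proof -
  obtain l where l: "l \<noteq> i" "l \<noteq> j" "l \<noteq> r"
    by (rule other_index)
  have "conj_diff i l 1 (X i j s) - conj_diff i j s (X i l 1) \<in> range mat"
    using commute assms l by simp
  from range_mat_off_diag[OF this, of r l] show ?thesis
    using assms l by (simp add: conj_diff_nth)
qed

lemma row_zero:
  assumes "i \<noteq> j" "r \<noteq> j"
  shows "X i j s $ j $ r = 0"
proof -
  obtain k where k: "k \<noteq> i" "k \<noteq> j" "k \<noteq> r"
    by (rule other_index)
  have "conj_diff k j 1 (X i j s) - conj_diff i j s (X k j 1) \<in> range mat"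
    using commute assms k by simp
  from range_mat_off_diag[OF this, of k r] show ?thesis
    using assms k by (simp add: conj_diff_nth)
qed

text \<open>Comparing positions \<open>(l, l)\<close> and \<open>(k, k)\<close> gives
  \<open>X_lk = - X_lk\<close>; at \<open>(k, l)\<close> the quadratic term of
  \<open>conj_diff\<close> brings in \<open>X_lk\<close>.\<close>

lemma disjoint:
  assumes "i \<noteq> j" "k \<noteq> i" "k \<noteq> j" "l \<noteq> i" "l \<noteq> j" "k \<noteq> l"
  shows "2 * X i j s $ l $ k = 0" "X i j s $ k $ k - X i j s $ l $ l = X i j s $ l $ k"
proof -
  have *: "conj_diff k l 1 (X i j s) - conj_diff i j s (X k l 1) \<in> range mat"
    using commute assms by simp
  have "X i j s $ l $ k = - X i j s $ l $ k"
    using range_mat_diag[OF *, of l k] assms by (simp add: conj_diff_nth)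
  then show "2 * X i j s $ l $ k = 0"
    by (metis add.right_inverse mult_2)
  show "X i j s $ k $ k - X i j s $ l $ l = X i j s $ l $ k"
    using range_mat_off_diag[OF *, of k l] assms by (simp add: conj_diff_nth)
qed

text \<open>With one parameter set to 1, this gives linear dependence on the other and links values
  at different index pairs.\<close>

lemma same_row:
  assumes "i \<noteq> j" "i \<noteq> l" "j \<noteq> l"
  shows "t * (X i j s $ i $ i - X i j s $ l $ l) = - s * X i l t $ j $ l"
    and "s * (X i l t $ i $ i - X i l t $ j $ j) = - t * X i j s $ l $ j"
proof -
  have *: "conj_diff i l t (X i j s) - conj_diff i j s (X i l t) \<in> range mat"
    using commute assms by simp
  show "t * (X i j s $ i $ i - X i j s $ l $ l) = - s * X i l t $ j $ l"
    using range_mat_off_diag[OF *, of i l] assms by (simp add: conj_diff_nth col_zero algebra_simps)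
  show "s * (X i l t $ i $ i - X i l t $ j $ j) = - t * X i j s $ l $ j"
    using range_mat_off_diag[OF *, of i j] assms by (simp add: conj_diff_nth col_zero algebra_simps eq_neg_iff_add_eq_0)
qed

lemma same_col:
  assumes "i \<noteq> j" "k \<noteq> i" "k \<noteq> j"
  shows "t * (X i j s $ k $ k - X i j s $ j $ j) = s * X k j t $ k $ i"
proof -
  have *: "conj_diff k j t (X i j s) - conj_diff i j s (X k j t) \<in> range mat"
    using commute assms by simp
  show ?thesis
    using range_mat_off_diag[OF *, of k j] assms by (simp add: conj_diff_nth row_zero algebra_simps)
qed

text \<open>For \<open>n = 4\<close> in characteristic 2, commuting pairs alone do not force
  \<open>X\<^sub>k\<^sub>k = X\<^sub>l\<^sub>l\<close>: for that the next two lemmas use the commutator relation and \<open>u\<^sub>i\<^sub>j(s)\<^sup>2 = 1\<close>.\<close>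

lemma diag_commutator:
  assumes "i \<noteq> j" "k \<noteq> i" "k \<noteq> j" "l \<noteq> i" "l \<noteq> j" "k \<noteq> l"
  shows "X i j s $ k $ k - X i j s $ l $ l = X i j s $ i $ i + X i j s $ j $ j - 2 * X i j s $ k $ k"
proof -
  have row: "X i j s $ i $ i - X i j s $ m $ m = - s * X i m 1 $ j $ m" if "m \<noteq> i" "m \<noteq> j" for m
    using same_row(1)[of i j m 1 s] that assms by auto
  have col: "X i j s $ k $ k - X i j s $ j $ j = s * X k j 1 $ k $ i"
    using same_col[of i j k 1 s] assms by auto
  show ?thesis
  proof (cases "s = 0")
    case True
    then show ?thesis
      using row[of k] row[of l] col assms by simp
  next
    case False
    \<comment> \<open>Both parameters are \<open>s\<close>, so cancelling leaves
      \<open>X i k s\<close>, which also occurs in the commutator relation below.\<close>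
    have "s * (X i j s $ i $ i - X i j s $ k $ k) = s * (- X i k s $ j $ k)"
      using same_row(1)[of i j k s s] assms by auto
    then have "X i j s $ i $ i - X i j s $ k $ k = - X i k s $ j $ k"
      using mult_left_cancel[OF False] by blast
    \<comment> \<open>Positions \<open>(k, k)\<close> and \<open>(l, l)\<close> must agree; at
      \<open>(l, l)\<close> only \<open>X i j s\<close> contributes.\<close>
    moreover have "X i j s $ k $ k + s * X k j 1 $ k $ i + X i k s $ j $ k = X i j s $ l $ l"
      using range_mat_diag[OF commutator[of i j k s 1], of k l] assms
      by (simp add: conj_diff_nth col_zero row_zero)
    ultimately have l: "X i j s $ l $ l = X i j s $ k $ k
        + (X i j s $ k $ k - X i j s $ j $ j) - (X i j s $ i $ i - X i j s $ k $ k)"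
      unfolding col by simp
    show ?thesis
      unfolding l by (simp add: algebra_simps)
  qed
qed

lemma diag_char_2:
  assumes "i \<noteq> j" "(2::'a) = 0"
  shows "X i j s $ i $ i = X i j s $ j $ j"
proof -
  obtain k where k: "k \<noteq> i" "k \<noteq> j"
    by (rule other_index[of i j j])
  have double: "x + x = 0" for x :: 'a
    using assms(2) by (metis mult_2 mult_zero_left)
  have "X i j 0 $ i $ j = 0"
    using range_mat_off_diag[OF additive[OF assms(1), of 0 0] assms(1)] assms
    by (simp add: conj_diff_nth)
  \<comment> \<open>Here \<open>s + s = 0\<close>, and \<open>conj_diff\<close> contributes the
    diagonal difference at position \<open>(i, j)\<close>.\<close>
  moreover have "X i j s $ i $ j + X i j s $ i $ j + s * (X i j s $ i $ i - X i j s $ j $ j) = X i j 0 $ i $ j"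
    using range_mat_off_diag[OF additive[OF assms(1), of s s] assms(1)] assms
    by (simp add: conj_diff_nth col_zero double algebra_simps)
  ultimately have "s * (X i j s $ i $ i - X i j s $ j $ j) = 0"
    by (simp add: double)
  \<comment> \<open>These settle \<open>s = 0\<close>, where the factor \<open>s\<close> cannot be
    cancelled.\<close>
  moreover have "X i j s $ i $ i - X i j s $ k $ k = - s * X i k 1 $ j $ k"
    "X i j s $ k $ k - X i j s $ j $ j = s * X k j 1 $ k $ i"
    using same_row(1)[of i j k 1 s] same_col[of i j k 1 s] k assms by auto
  ultimately show ?thesis
    by (cases "s = 0") auto
qed

text \<open>Outside characteristic 2 this is \<open>disjoint\<close>. In characteristic 2,
  \<open>X_lk = X_ii + X_jj - 2 X_kk\<close>, which vanishes since
  \<open>X_ii = X_jj\<close>.\<close>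

lemma block:
  assumes "i \<noteq> j" "k \<noteq> i" "k \<noteq> j" "l \<noteq> i" "l \<noteq> j" "k \<noteq> l"
  shows "X i j s $ l $ k = 0" "X i j s $ k $ k = X i j s $ l $ l"
proof -
  show *: "X i j s $ l $ k = 0"
  proof (cases "(2::'a) = 0")
    case False
    then show ?thesis
      using disjoint(1)[OF assms] by simp
  next
    case True
    have "X i j s $ l $ k = X i j s $ i $ i + X i j s $ j $ j - 2 * X i j s $ k $ k"
      using disjoint(2)[OF assms] diag_commutator[OF assms] by simp
    also have "\<dots> = 2 * X i j s $ j $ j - 2 * X i j s $ k $ k"
      using diag_char_2[OF assms(1) True] by simp
    finally show ?thesis
      using True by (simp only: mult_zero_left diff_self)
  qed
  show "X i j s $ k $ k = X i j s $ l $ l"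
    using disjoint(2)[OF assms, of s] * by simp
qed

lemma diag_sum:
  assumes "i \<noteq> j" "k \<noteq> i" "k \<noteq> j"
  shows "X i j s $ i $ i + X i j s $ j $ j = 2 * X i j s $ k $ k"
proof -
  obtain l where "l \<noteq> i" "l \<noteq> j" "l \<noteq> k"
    by (rule other_index)
  then show ?thesis
    using diag_commutator[of i j k l s] block(2)[of i j k l s] assms by auto
qed

text \<open>The \<open>SOME\<close> is harmless: by \<open>block\<close>, any \<open>k\<close> different from \<open>i\<close> and \<open>j\<close> gives the same value.\<close>

definition correction :: "'a^'n^'n" where
  "correction = (\<chi> j i. if i = j then 0
     else let k = SOME k. k \<noteq> i \<and> k \<noteq> j in X i j 1 $ i $ i - X i j 1 $ k $ k)"

section \<open>Comparison with the coboundary of one matrix\<close>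

text \<open>The indices are swapped because \<open>conj_diff i j 1 v\<close> has the entry
  \<open>- v_ji\<close> at \<open>(i, i)\<close>, which has to cancel this difference.\<close>

lemma correction_nth:
  assumes "i \<noteq> j" "k \<noteq> i" "k \<noteq> j"
  shows "correction $ j $ i = X i j 1 $ i $ i - X i j 1 $ k $ k"
proof -
  define m where "m = (SOME k. k \<noteq> i \<and> k \<noteq> j)"
  have "m \<noteq> i \<and> m \<noteq> j"
    unfolding m_def by (rule someI[of _ k]) (use assms in auto)
  then show ?thesis
    using assms block(2)[of i j m k 1] by (cases "m = k") (auto simp: correction_def Let_def simp flip: m_def)
qed

lemma correction_col:
  assumes "i \<noteq> j" "l \<noteq> i" "l \<noteq> j"
  shows "X i j s $ l $ j = - s * correction $ l $ i"
proof -
  have "correction $ l $ i = X i l 1 $ i $ i - X i l 1 $ j $ j"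
    using correction_nth[of i l j] assms by auto
  moreover have "s * (X i l 1 $ i $ i - X i l 1 $ j $ j) = - 1 * X i j s $ l $ j"
    using same_row(2)[of i j l s 1] assms by auto
  ultimately show ?thesis
    by simp
qed

text \<open>\<open>same_col\<close> yields \<open>X_kk - X_jj\<close> instead of
  \<open>X_ii - X_kk\<close>; by \<open>diag_sum\<close> they agree, so one matrix serves both rows
  and columns.\<close>

lemma correction_row:
  assumes "i \<noteq> j" "k \<noteq> i" "k \<noteq> j"
  shows "X k j t $ k $ i = t * correction $ j $ i"
proof -
  have "X i j 1 $ j $ j = 2 * X i j 1 $ k $ k - X i j 1 $ i $ i"
    using diag_sum[OF assms, of 1] by (simp only: eq_diff_eq add.commute)
  then have "X i j 1 $ k $ k - X i j 1 $ j $ j = correction $ j $ i"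
    by (simp add: correction_nth[OF assms])
  then show ?thesis
    using same_col[of i j k t 1] assms by simp
qed

lemma correction_diag:
  assumes "i \<noteq> j" "k \<noteq> i" "k \<noteq> j"
  shows "X i j s $ i $ i = X i j s $ k $ k + s * correction $ j $ i"
proof -
  have "X i j s $ i $ i - X i j s $ k $ k = s * correction $ j $ i"
    \<comment> \<open>The detour through \<open>X i k 1\<close> extends the definition from
      parameter 1 to all \<open>s\<close>.\<close>
    using same_row(2)[of i k j 1 s] correction_col[of i k j 1] assms by (simp add: not_sym)
  then show ?thesis
    by (simp only: diff_eq_eq add.commute)
qed

text \<open>Removing the coboundary adds \<open>conj_diff i j s correction\<close> to
  \<open>X i j s\<close>; the term with \<open>s * s\<close> is its quadratic part.\<close>

lemma corrected:
  assumes "i \<noteq> j"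
  shows "f (transvection i j s) - (mat_class correction - conj_act (mat_class correction) (transvection i j s))
    = mat_class (mat_scale (X i j s $ i $ j - s * s * correction $ j $ i) (mat_unit i j))"
proof -
  let ?v = correction
  obtain k where k: "k \<noteq> i" "k \<noteq> j"
    by (rule other_index[of i j j])
  \<comment> \<open>A diagonal part would only change position \<open>(i, j)\<close>; it is chosen
    later, as \<open>D\<close> in \<open>derivation_form\<close>.\<close>
  have diag: "?v $ m $ m = 0" for m
    by (simp add: correction_def)
  note entries = conj_diff_nth mat_scale_def mat_unit_def mat_def
  have jj: "X i j s $ j $ j = X i j s $ k $ k - s * correction $ j $ i"
    using diag_sum[of i j k s] correction_diag[of i j k s] assms k by (simp add: algebra_simps)
  have "X i j s + conj_diff i j s ?v - mat_scale (X i j s $ i $ j - s * s * ?v $ j $ i) (mat_unit i j)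
      = mat (X i j s $ k $ k)" (is "?L = _")
  proof -
    have "?L $ r $ q = mat (X i j s $ k $ k) $ r $ q" for r q
    proof -
      consider "r = i" "q = i" | "r = i" "q = j" | "r = i" "q \<noteq> i" "q \<noteq> j" | "r = j" "q = j"
        | "r = j" "q \<noteq> j" | "r \<noteq> i" "r \<noteq> j" "q = j" | "r \<noteq> i" "r \<noteq> j" "q = i"
        | "r \<noteq> i" "r \<noteq> j" "q \<noteq> i" "q \<noteq> j" "r = q" | "r \<noteq> i" "r \<noteq> j" "q \<noteq> i" "q \<noteq> j" "r \<noteq> q"
        by blast
      then show ?thesis
      proof cases
        case 1
        then show ?thesis
          using assms correction_diag[OF assms k, of s] by (simp add: entries diag)
      next
        case 2
        then show ?thesis
          using assms by (simp add: entries diag)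
      next
        case 3
        then show ?thesis
          using assms correction_row[of q j i s] by (simp add: entries)
      next
        case 4
        then show ?thesis
          using assms jj by (simp add: entries)
      next
        case 5
        then show ?thesis
          using assms by (simp add: entries row_zero)
      next
        case 6
        then show ?thesis
          using assms correction_col[of i j r s] by (simp add: entries)
      next
        case 7
        then show ?thesis
          using assms by (simp add: entries col_zero)
      next
        case 8
        then show ?thesis
          using assms block(2)[of i j k r s] k by (cases "r = k") (simp_all add: entries)
      next
        case 9
        then show ?thesis
          using assms block(1)[of i j q r s] by (simp add: entries)
      qed
    qed
    then show ?thesis
      by (simp add: vec_eq_iff)
  qed
  then have "mat_class (X i j s + conj_diff i j s ?v)
      = mat_class (mat_scale (X i j s $ i $ j - s * s * ?v $ j $ i) (mat_unit i j))"
    by (simp add: mat_class_eq_iff)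
  then show ?thesis
    using assms by (simp add: f_eq conj_act_transvection flip: mat_class_add)
qed

end


section \<open>Changing a cocycle by a coboundary\<close>

lemma conj_act_diff:
  assumes "g \<in> carrier SL"
  shows "conj_act (v - w) g = conj_act v g - conj_act w g"
  using conj_act_right_action(3)[OF assms assms, of "v - w" w] by (simp add: algebra_simps)

definition twist ::
  "('a::field^'n^'n \<Rightarrow> ('a, 'n::finite) mat_mod_scalars) \<Rightarrow> ('a, 'n) mat_mod_scalars \<Rightarrow> 'a^'n^'n \<Rightarrow> ('a, 'n) mat_mod_scalars" where
  "twist f v = (\<lambda>g\<in>carrier SL. f g - (v - conj_act v g))"

lemma twist_cocycle:
  assumes "f \<in> cocycles SL conj_act"
  shows "twist f v \<in> cocycles SL conj_act"
proof -
  have "twist f v (g ** h) = conj_act (twist f v g) h + twist f v h"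
    if gh: "g \<in> carrier SL" "h \<in> carrier SL" for g h
  proof -
    have "g ** h \<in> carrier SL"
      using gh by (simp add: det_mul)
    then show ?thesis
      using gh by (simp add: twist_def cocycleD[OF assms] conj_act_diff conj_act_right_action(2) del: SL_simps)
  qed
  then show ?thesis
    by (auto simp: cocycles_def twist_def)
qed

text \<open>A cocycle \<open>h\<close> is cohomologous to both or to neither: the witness
  \<open>w\<close> is shifted by \<open>v\<close>.\<close>

lemma cohomology_class_twist:
  assumes "f \<in> cocycles SL conj_act"
  shows "cohomology_class SL conj_act (twist f v) = cohomology_class SL conj_act f"
proof -
  have "(\<lambda>g\<in>carrier SL. twist f v g - h g) \<in> coboundaries SL conj_act
      \<longleftrightarrow> (\<lambda>g\<in>carrier SL. f g - h g) \<in> coboundaries SL conj_act" for h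
  proof
    assume "(\<lambda>g\<in>carrier SL. twist f v g - h g) \<in> coboundaries SL conj_act"
    then obtain w where w: "(\<lambda>g\<in>carrier SL. twist f v g - h g) = (\<lambda>g\<in>carrier SL. w - conj_act w g)"
      by (auto simp: coboundaries_def)
    have "f g - h g = (w + v) - conj_act (w + v) g" if "g \<in> carrier SL" for g
      using fun_cong[OF w, of g] that
      by (simp add: twist_def conj_act_right_action(3)[OF that that] algebra_simps del: SL_simps)
    then have "(\<lambda>g\<in>carrier SL. f g - h g) = (\<lambda>g\<in>carrier SL. (w + v) - conj_act (w + v) g)"
      by (intro restrict_ext)
    then show "(\<lambda>g\<in>carrier SL. f g - h g) \<in> coboundaries SL conj_act"
      unfolding coboundaries_def by (rule range_eqI)
  next
    assume "(\<lambda>g\<in>carrier SL. f g - h g) \<in> coboundaries SL conj_act"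
    then obtain w where w: "(\<lambda>g\<in>carrier SL. f g - h g) = (\<lambda>g\<in>carrier SL. w - conj_act w g)"
      by (auto simp: coboundaries_def)
    have "twist f v g - h g = (w - v) - conj_act (w - v) g" if "g \<in> carrier SL" for g
      using fun_cong[OF w, of g] that
      by (simp add: twist_def conj_act_diff[OF that] algebra_simps del: SL_simps)
    then have "(\<lambda>g\<in>carrier SL. twist f v g - h g) = (\<lambda>g\<in>carrier SL. (w - v) - conj_act (w - v) g)"
      by (intro restrict_ext)
    then show "(\<lambda>g\<in>carrier SL. twist f v g - h g) \<in> coboundaries SL conj_act"
      unfolding coboundaries_def by (rule range_eqI)
  qed
  then show ?thesis
    using assms twist_cocycle[OF assms] by (auto simp: cohomology_class_def cohomologous_def)
qed

lemma cocycle_normal_form: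
  fixes f :: "'a::field^'n^'n \<Rightarrow> ('a, 'n::finite) mat_mod_scalars"
  assumes "CARD('n) > 3" "f \<in> cocycles SL conj_act"
  obtains v q where "\<And>i j s. i \<noteq> j \<Longrightarrow>
    twist f v (transvection i j s) = mat_class (mat_scale (q i j s) (mat_unit i j))"
proof -
  interpret transvection_cocycle f "\<lambda>i j s. mat_rep (f (transvection i j s))"
    using assms by unfold_locales simp_all
  show thesis
    by (rule that[of "mat_class correction"])
      (use corrected in \<open>simp add: twist_def transvection_in_SL del: SL_simps\<close>)
qed


section \<open>The derivation\<close>

locale elementary_cocycle = transvection_cocycle f "\<lambda>i j s. mat_scale (q i j s) (mat_unit i j)"
  for f :: "'a::field^'n^'n \<Rightarrow> ('a, 'n::finite) mat_mod_scalars" and q :: "'n \<Rightarrow> 'n \<Rightarrow> 'a \<Rightarrow> 'a"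
begin

lemma q_add:
  assumes "i \<noteq> j"
  shows "q i j (s + t) = q i j s + q i j t"
  using range_mat_off_diag[OF additive[OF assms, of s t] assms] assms
  by (simp add: conj_diff_nth mat_scale_def mat_unit_def)

lemma q_mult:
  assumes "i \<noteq> j" "i \<noteq> k" "j \<noteq> k"
  shows "q i j (s * t) = t * q i k s + s * q k j t"
  using range_mat_off_diag[OF commutator[OF assms, of s t] assms(1)] assms
  by (simp add: conj_diff_nth mat_scale_def mat_unit_def algebra_simps)

text \<open>Subtracting the linear part makes the value at 1 vanish, as for a derivation; that part
  comes from a diagonal coboundary.\<close>

definition deriv_at :: "'n \<Rightarrow> 'n \<Rightarrow> 'a \<Rightarrow> 'a" where
  "deriv_at i j s = q i j s - s * q i j 1"

lemma deriv_at_mult: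
  assumes "i \<noteq> j" "i \<noteq> k" "j \<noteq> k"
  shows "deriv_at i j (s * t) = t * deriv_at i k s + s * deriv_at k j t"
  using q_mult[OF assms, of s t] q_mult[OF assms, of 1 1]
  by (simp add: deriv_at_def algebra_simps)

lemma deriv_at_1 [simp]: "deriv_at i j 1 = 0"
  by (simp add: deriv_at_def)

text \<open>Put \<open>t = 1\<close> in the product rule, where the second term vanishes.\<close>

lemma deriv_at_row:
  assumes "i \<noteq> j" "i \<noteq> k"
  shows "deriv_at i j s = deriv_at i k s"
  using deriv_at_mult[of i j k s 1] assms by (cases "j = k") auto

lemma deriv_at_col:
  assumes "i \<noteq> j" "k \<noteq> j"
  shows "deriv_at i j s = deriv_at k j s"
  using deriv_at_mult[of i j k 1 s] assms by (cases "i = k") auto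

lemma deriv_at_eq:
  assumes "i \<noteq> j" "k \<noteq> l"
  shows "deriv_at i j s = deriv_at k l s"
proof -
  \<comment> \<open>The path is \<open>(i, j)\<close>, \<open>(i, m)\<close>, \<open>(k, m)\<close>,
    \<open>(k, l)\<close>; \<open>m\<close> may equal \<open>j\<close> or \<open>l\<close>.\<close>
  obtain m where "m \<noteq> i" "m \<noteq> k"
    by (rule other_index[of i k k])
  then show ?thesis
    using deriv_at_row[of i j m s] deriv_at_col[of i m k s] deriv_at_row[of k m l s] assms by auto
qed

lemma derivation_deriv_at:
  assumes "i \<noteq> j"
  shows "derivation (deriv_at i j)"
proof -
  obtain k where "k \<noteq> i" "k \<noteq> j"
    by (rule other_index[of i j j])
  then have "deriv_at i j (s * t) = deriv_at i j s * t + s * deriv_at i j t" for s t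
    using deriv_at_mult[of i j k s t] deriv_at_eq[of i k i j s] deriv_at_eq[of k j i j t] assms
    by simp
  moreover have "deriv_at i j (s + t) = deriv_at i j s + deriv_at i j t" for s t
    using q_add[OF assms, of s t] by (simp add: deriv_at_def algebra_simps)
  ultimately show ?thesis
    by (simp add: derivation_def)
qed

text \<open>The values at 1 add up along paths of distinct indices, so summing from a base index
  \<open>z\<close> gives a potential. Antisymmetry needs a third index.\<close>

lemma q_one_potential: obtains d where "\<And>i j. i \<noteq> j \<Longrightarrow> q i j 1 = d j - d i"
proof -
  have add: "q i j 1 = q i k 1 + q k j 1" if "i \<noteq> j" "i \<noteq> k" "j \<noteq> k" for i j k
    using q_mult[OF that, of 1 1] by simp
  have anti: "q i j 1 = - q j i 1" if "i \<noteq> j" for i j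
  proof -
    obtain k where "k \<noteq> i" "k \<noteq> j"
      by (rule other_index[of i j j])
    then show ?thesis
      using add[of k i j] add[of k j i] that by (simp add: eq_neg_iff_add_eq_0)
  qed
  fix z :: 'n
  define d where "d j = (if j = z then 0 else q z j 1)" for j
  have "q i j 1 = d j - d i" if "i \<noteq> j" for i j
    using add[of z j i] anti[of i z] that by (auto simp: d_def)
  then show thesis
    by (rule that)
qed

lemma derivation_form:
  obtains \<alpha> v where "derivation \<alpha>"
    "\<And>i j s. i \<noteq> j \<Longrightarrow> twist f v (transvection i j s) = mat_class (mat_scale (\<alpha> s) (mat_unit i j))"
proof -
  fix a :: 'n
  obtain b where "b \<noteq> a"
    by (rule other_index[of a a a])
  then have ab: "a \<noteq> b"
    by simp
  obtain d where d: "\<And>i j. i \<noteq> j \<Longrightarrow> q i j 1 = d j - d i"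
    using q_one_potential by metis
  define D :: "'a^'n^'n" where "D = (\<chi> i j. if i = j then d i else 0)"
  have "twist f (mat_class D) (transvection i j s) = mat_class (mat_scale (deriv_at a b s) (mat_unit i j))"
    if "i \<noteq> j" for i j s
  proof -
    \<comment> \<open>For diagonal \<open>D\<close>, the only entry of
      \<open>conj_diff i j s D\<close> is \<open>s * (d i - d j) = - s * q i j 1\<close>, at
      \<open>(i, j)\<close>.\<close>
    have "mat_scale (q i j s) (mat_unit i j) + conj_diff i j s D = mat_scale (deriv_at i j s) (mat_unit i j)"
      using that
      by (auto simp: vec_eq_iff D_def deriv_at_def d[OF that] conj_diff_nth mat_scale_def mat_unit_def algebra_simps)
    then show ?thesis
      using that deriv_at_eq[OF ab that]
      by (simp add: twist_def transvection_in_SL f_eq conj_act_transvection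
          flip: mat_class_add del: SL_simps) (simp add: mat_class_add)
  qed
  then show thesis
    using that derivation_deriv_at[OF ab] by blast
qed

end

theorem lemma1p9:
  fixes \<phi> :: "('a::field^'n^'n \<Rightarrow> ('a, 'n::finite) mat_mod_scalars) set"
  assumes "CARD('n) > 3"
    and "\<phi> \<in> H1 SL conj_act"
  shows "\<exists>\<alpha> f. derivation \<alpha> \<and> f \<in> cocycles SL conj_act \<and> cohomology_class SL conj_act f = \<phi> \<and>
    (\<forall>k h s. k \<noteq> h \<longrightarrow> f (transvection k h s) = mat_class (mat_scale (\<alpha> s) (mat_unit k h)))"
proof -
  obtain f where f: "f \<in> cocycles SL conj_act" "\<phi> = cohomology_class SL conj_act f"
    using assms(2) by (auto simp: H1_def cohomology_class_def elim: quotientE)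
  obtain v q where q: "\<And>i j s. i \<noteq> j \<Longrightarrow>
      twist f v (transvection i j s) = mat_class (mat_scale (q i j s) (mat_unit i j))"
    using cocycle_normal_form[OF assms(1) f(1)] by metis
  interpret elementary_cocycle "twist f v" q
    using assms(1) twist_cocycle[OF f(1)] q by unfold_locales
  obtain \<alpha> w where \<alpha>: "derivation \<alpha>" "\<And>i j s. i \<noteq> j \<Longrightarrow>
      twist (twist f v) w (transvection i j s) = mat_class (mat_scale (\<alpha> s) (mat_unit i j))"
    using derivation_form by metis
  have "cohomology_class SL conj_act (twist (twist f v) w) = \<phi>"
    by (simp only: cohomology_class_twist[OF cocycle] cohomology_class_twist[OF f(1)] f(2))
  with \<alpha> twist_cocycle[OF cocycle, of w] show ?thesis
    by (intro exI[of _ \<alpha>] exI[of _ "twist (twist f v) w"]) simp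
qed

end
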